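(* Let $(\mathfrak g,[\cdot,\cdot]_{\mathfrak g},\phi_{\mathfrak g})$ be a Hom-Lie algebra. Then $(\mathsf{Der}(\mathfrak g),[\cdot,\cdot]_{\phi_{\mathfrak g}},\mathsf{Ad}_{\phi_{\mathfrak g}})$ is a Hom-Lie algebra, which is a subalgebra of the Hom-Lie algebra $(\mathfrak{gl}(\mathfrak g),[\cdot,\cdot]_{\phi_{\mathfrak g}},\mathsf{Ad}_{\phi_{\mathfrak g}})$.
   Context: Vector spaces are over a fixed ground field. A Hom-Lie algebra $(\mathfrak g,[\cdot,\cdot]_{\mathfrak g},\phi_{\mathfrak g})$ is a vector space $\mathfrak g$ with a skew-symmetric bilinear bracket (a linear map on $\wedge^2\mathfrak g$) and a linear map $\phi_{\mathfrak g}:\mathfrak g\to\mathfrak g$ preserving the bracket, such that $[\phi_{\mathfrak g}(x),[y,z]_{\mathfrak g}]_{\mathfrak g}+[\phi_{\mathfrak g}(y),[z,x]_{\mathfrak g}]_{\mathfrak g}+[\phi_{\mathfrak g}(z),[x,y]_{\mathfrak g}]_{\mathfrak g}=0$. Throughout, $\phi_{\mathfrak g}$ is assumed to be an algebra automorphism. For a linear automorphism $\beta$ of a vector space $V$ and $A,B\in\mathfrak{gl}(V)$ put $\mathsf{Ad}_\beta(A)=\beta\circ A\circ\beta^{-1}$ and $[A,B]_\beta=\beta\circ A\circ\beta^{-1}\circ B\circ\beta^{-1}-\beta\circ B\circ\beta^{-1}\circ A\circ\beta^{-1}$. It is known that $(\mathfrak{gl}(V),[\cdot,\cdot]_\beta,\mathsf{Ad}_\beta)$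 is a Hom-Lie algebra whose structure map is an automorphism. A derivation of $\mathfrak g$ is a linear map $D:\mathfrak g\to\mathfrak g$ with $D[x,y]_{\mathfrak g}=[\phi_{\mathfrak g}(x),(\mathsf{Ad}_{\phi_{\mathfrak g}^{-1}}D)(y)]_{\mathfrak g}+[(\mathsf{Ad}_{\phi_{\mathfrak g}^{-1}}D)(x),\phi_{\mathfrak g}(y)]_{\mathfrak g}$ for all $x,y\in\mathfrak g$; $\mathsf{Der}(\mathfrak g)$ is the set of derivations. A subalgebra of a Hom-Lie algebra is a subspace closed under the bracket and under the structure map. *)

theory Defs
  imports Complex_Main "HOL-Library.Function_Algebras"
begin

text \<open>
  A Hom-Lie algebra is carried by a subspace \<open>L\<close> of an ambient vector space, so that \<open>gl\<close> and \<open>Der\<close>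
  can live inside the space of all self-maps with its pointwise operations. Skew-symmetry is
  \<open>[x,x] = 0\<close>, i.e. the bracket is a linear map on the exterior square, also in
  characteristic 2. The structure map is required to be an automorphism of \<open>L\<close>; nothing is
  required of the bracket or of the structure map outside \<open>L\<close>.
\<close>

locale hom_lie_algebra = vector_space scale
  for scale :: "'k::field \<Rightarrow> 'v::ab_group_add \<Rightarrow> 'v" +
  fixes L :: "'v set"
    and bracket :: "'v \<Rightarrow> 'v \<Rightarrow> 'v"
    and \<phi> :: "'v \<Rightarrow> 'v"
  assumes subspace_carrier: "subspace L"
    and bracket_closed: "\<lbrakk>x \<in> L; y \<in> L\<rbrakk> \<Longrightarrow> bracket x y \<in> L"
    and bracket_add_left:
      "\<lbrakk>x \<in> L; y \<in> L; z \<in> L\<rbrakk> \<Longrightarrow> bracket (x + y) z = bracket x z + bracket y z"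
    and bracket_add_right:
      "\<lbrakk>x \<in> L; y \<in> L; z \<in> L\<rbrakk> \<Longrightarrow> bracket x (y + z) = bracket x y + bracket x z"
    and bracket_scale_left:
      "\<lbrakk>x \<in> L; y \<in> L\<rbrakk> \<Longrightarrow> bracket (scale c x) y = scale c (bracket x y)"
    and bracket_scale_right:
      "\<lbrakk>x \<in> L; y \<in> L\<rbrakk> \<Longrightarrow> bracket x (scale c y) = scale c (bracket x y)"
    and bracket_self: "x \<in> L \<Longrightarrow> bracket x x = 0"
    and map_bij: "bij_betw \<phi> L L"
    and map_add: "\<lbrakk>x \<in> L; y \<in> L\<rbrakk> \<Longrightarrow> \<phi> (x + y) = \<phi> x + \<phi> y"
    and map_scale: "x \<in> L \<Longrightarrow> \<phi> (scale c x) = scale c (\<phi> x)"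
    and map_bracket: "\<lbrakk>x \<in> L; y \<in> L\<rbrakk> \<Longrightarrow> \<phi> (bracket x y) = bracket (\<phi> x) (\<phi> y)"
    and hom_jacobi: "\<lbrakk>x \<in> L; y \<in> L; z \<in> L\<rbrakk> \<Longrightarrow>
      bracket (\<phi> x) (bracket y z) + bracket (\<phi> y) (bracket z x) + bracket (\<phi> z) (bracket x y) = 0"

locale hom_lie_subalgebra = hom_lie_algebra scale L bracket \<phi>
  for scale :: "'k::field \<Rightarrow> 'v::ab_group_add \<Rightarrow> 'v"
    and L :: "'v set"
    and bracket :: "'v \<Rightarrow> 'v \<Rightarrow> 'v"
    and \<phi> :: "'v \<Rightarrow> 'v" +
  fixes H :: "'v set"
  assumes sub_subset: "H \<subseteq> L"
    and sub_subspace: "subspace H"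
    and sub_bracket_closed: "\<lbrakk>x \<in> H; y \<in> H\<rbrakk> \<Longrightarrow> bracket x y \<in> H"
    and sub_map_closed: "x \<in> H \<Longrightarrow> \<phi> x \<in> H"

definition pointwise_scale ::
    "('k \<Rightarrow> 'v \<Rightarrow> 'v) \<Rightarrow> 'k \<Rightarrow> ('v \<Rightarrow> 'v) \<Rightarrow> 'v \<Rightarrow> 'v" where
  "pointwise_scale scale c A = (\<lambda>x. scale c (A x))"

definition gl :: "('k::field \<Rightarrow> 'v::ab_group_add \<Rightarrow> 'v) \<Rightarrow> ('v \<Rightarrow> 'v) set" where
  "gl scale = {A. Vector_Spaces.linear scale scale A}"

definition Ad :: "('v \<Rightarrow> 'v) \<Rightarrow> ('v \<Rightarrow> 'v) \<Rightarrow> 'v \<Rightarrow> 'v" where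
  "Ad \<beta> A = \<beta> \<circ> A \<circ> inv \<beta>"

definition gl_bracket ::
    "('v \<Rightarrow> 'v) \<Rightarrow> ('v \<Rightarrow> 'v) \<Rightarrow> ('v \<Rightarrow> 'v) \<Rightarrow> 'v \<Rightarrow> 'v::ab_group_add" where
  "gl_bracket \<beta> A B =
     (\<beta> \<circ> A \<circ> inv \<beta> \<circ> B \<circ> inv \<beta>) - (\<beta> \<circ> B \<circ> inv \<beta> \<circ> A \<circ> inv \<beta>)"

definition Der ::
    "('k::field \<Rightarrow> 'v::ab_group_add \<Rightarrow> 'v) \<Rightarrow> ('v \<Rightarrow> 'v \<Rightarrow> 'v) \<Rightarrow> ('v \<Rightarrow> 'v) \<Rightarrow> ('v \<Rightarrow> 'v) set" where
  "Der scale bracket \<phi> = {D. Vector_Spaces.linear scale scale D \<and>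
     (\<forall>x y. D (bracket x y) =
        bracket (\<phi> x) (Ad (inv \<phi>) D y) + bracket (Ad (inv \<phi>) D x) (\<phi> y))}"

end

theory Submission imports Defs begin

text \<open>
  The idea is to untwist. Since \<open>\<phi>\<close> is an automorphism, \<open>x, y \<mapsto> \<phi>\<inverse> [x, y]\<close> is an
  ordinary Lie bracket of which \<open>\<phi>\<close> is still an automorphism, and \<open>D\<close> is a derivation of the
  Hom-Lie algebra iff \<open>\<phi>\<inverse> \<circ> D\<close> satisfies the ordinary Leibniz rule for that bracket
  (lemma \<open>Der_iff_untwist\<close>). Under \<open>A \<mapsto> \<phi>\<inverse> \<circ> A\<close> the bracket of \<open>gl\<close> becomes the
  commutator followed by conjugation with \<open>\<phi>\<close>, and the structure map \<open>Ad \<phi>\<close> becomes that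
  conjugation (lemmas \<open>untwist_gl_bracket\<close> and \<open>untwist_Ad\<close>).

  Closure of the derivations is then the classical fact that the maps obeying the Leibniz
  rule are closed under linear combinations, under commutators and under conjugation by an
  automorphism. Conjugation by \<open>\<phi>\<inverse>\<close> preserves them as well, so \<open>Ad \<phi>\<close> maps
  \<open>Der\<close> onto itself; this makes the subalgebra \<open>Der\<close> a Hom-Lie algebra with an
  automorphism as structure map (lemma \<open>hom_lie_algebra_restrict\<close>). On the whole of \<open>gl\<close>, the
  Hom-Jacobi identity untwists to the Jacobi identity of the commutator, conjugated twice
  by \<open>\<phi>\<close>.
\<close>

section \<open>The Hom-Lie algebra of endomorphisms\<close>

lemma vector_space_pointwise_scale:
  assumes "vector_space scale"
  shows "vector_space (pointwise_scale scale)"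
proof -
  interpret vector_space scale by fact
  show ?thesis
    by unfold_locales
      (auto simp: pointwise_scale_def fun_eq_iff scale_right_distrib scale_left_distrib)
qed

lemma gl_iff:
  assumes "vector_space scale"
  shows "A \<in> gl scale \<longleftrightarrow>
    (\<forall>x y. A (x + y) = A x + A y) \<and> (\<forall>c x. A (scale c x) = scale c (A x))"
  using assms by (simp add: gl_def Vector_Spaces.linear_iff)

lemma gl_compose:
  assumes "vector_space scale" "A \<in> gl scale" "B \<in> gl scale"
  shows "A \<circ> B \<in> gl scale"
  using assms(2,3) by (simp add: gl_iff[OF assms(1)])

lemma gl_diff:
  assumes "vector_space scale" "A \<in> gl scale" "B \<in> gl scale"
  shows "A - B \<in> gl scale"
proof -
  interpret vector_space scale by fact
  show ?thesis
    using assms(2,3) by (simp add: gl_iff[OF assms(1)] scale_right_diff_distrib)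
qed

lemma gl_inv:
  assumes "vector_space scale" "\<beta> \<in> gl scale" "bij \<beta>"
  shows "inv \<beta> \<in> gl scale"
proof -
  have [simp]: "inv \<beta> (\<beta> x) = x" "\<beta> (inv \<beta> x) = x" for x
    using assms(3) by (simp_all add: bij_is_inj bij_is_surj surj_f_inv_f)
  have "inv \<beta> (x + y) = inv \<beta> x + inv \<beta> y" for x y
    using assms(2) by (simp add: inv_f_eq[OF bij_is_inj[OF assms(3)]] gl_iff[OF assms(1)])
  moreover have "inv \<beta> (scale c x) = scale c (inv \<beta> x)" for c x
    using assms(2) by (simp add: inv_f_eq[OF bij_is_inj[OF assms(3)]] gl_iff[OF assms(1)])
  ultimately show ?thesis by (simp add: gl_iff[OF assms(1)])
qed

lemma gl_Ad:
  assumes "vector_space scale" "\<beta> \<in> gl scale" "bij \<beta>" "A \<in> gl scale"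
  shows "Ad \<beta> A \<in> gl scale"
  unfolding Ad_def by (intro gl_compose gl_inv assms)

lemma gl_gl_bracket:
  assumes "vector_space scale" "\<beta> \<in> gl scale" "bij \<beta>" "A \<in> gl scale" "B \<in> gl scale"
  shows "gl_bracket \<beta> A B \<in> gl scale"
  unfolding gl_bracket_def by (intro gl_compose gl_diff gl_inv assms)

lemma subspace_gl:
  assumes "vector_space scale"
  shows "module.subspace (pointwise_scale scale) (gl scale)"
proof -
  interpret vector_space scale by fact
  interpret P: vector_space "pointwise_scale scale"
    by (rule vector_space_pointwise_scale) fact
  show ?thesis
    by (rule P.subspaceI)
      (auto simp: gl_iff[OF assms] pointwise_scale_def scale_right_distrib ac_simps)
qed

lemma Ad_Ad_inv:
  assumes "bij \<beta>"
  shows "Ad \<beta> (Ad (inv \<beta>) A) = A" "Ad (inv \<beta>) (Ad \<beta> A) = A"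
  using assms
  by (simp_all add: Ad_def fun_eq_iff inv_inv_eq bij_is_inj bij_is_surj surj_f_inv_f)

lemma bij_betw_Ad:
  assumes "bij \<beta>"
    and "\<And>A. A \<in> S \<Longrightarrow> Ad \<beta> A \<in> S" and "\<And>A. A \<in> S \<Longrightarrow> Ad (inv \<beta>) A \<in> S"
  shows "bij_betw (Ad \<beta>) S S"
  by (rule bij_betw_byWitness[where f' = "Ad (inv \<beta>)"])
    (use assms Ad_Ad_inv[OF assms(1)] in auto)

text \<open>
  Writing \<open>A = \<beta> \<circ> a\<close> and so on, each Hom-Jacobi term is \<open>\<beta>\<close> composed with the iterated
  commutator of \<open>a\<close>, \<open>b\<close>, \<open>c\<close> conjugated by \<open>\<beta>\<^sup>2\<close>; expanded at a vector, the
  twelve triple products cancel in pairs.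
\<close>

lemma hom_lie_algebra_gl:
  assumes V: "vector_space scale" and lin: "\<beta> \<in> gl scale" and bij: "bij \<beta>"
  shows "hom_lie_algebra (pointwise_scale scale) (gl scale) (gl_bracket \<beta>) (Ad \<beta>)"
proof -
  interpret vector_space scale by fact
  interpret P: vector_space "pointwise_scale scale"
    by (rule vector_space_pointwise_scale) fact
  have inv [simp]: "inv \<beta> (\<beta> x) = x" "\<beta> (inv \<beta> x) = x" for x
    using bij by (simp_all add: bij_is_inj bij_is_surj surj_f_inv_f)
  have add: "A (x + y) = A x + A y" if "A \<in> gl scale" for A x y
    using that by (simp add: gl_iff[OF V])
  have sc: "A (scale c x) = scale c (A x)" if "A \<in> gl scale" for A c x
    using that by (simp add: gl_iff[OF V])
  have diff: "A (x - y) = A x - A y" if "A \<in> gl scale" for A x y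
    using add[OF that, of "x - y" y] by (simp add: algebra_simps)
  have lin': "inv \<beta> \<in> gl scale" by (rule gl_inv[OF V lin bij])
  note expand = gl_bracket_def Ad_def fun_eq_iff pointwise_scale_def
    add[OF lin] add[OF lin'] sc[OF lin] sc[OF lin'] diff[OF lin] diff[OF lin']
  have Ad_onto: "bij_betw (Ad \<beta>) (gl scale) (gl scale)"
  proof (rule bij_betw_Ad[OF bij])
    show "Ad \<beta> A \<in> gl scale" if "A \<in> gl scale" for A
      by (rule gl_Ad[OF V lin bij that])
    show "Ad (inv \<beta>) A \<in> gl scale" if "A \<in> gl scale" for A
      by (rule gl_Ad[OF V lin' bij_imp_bij_inv[OF bij] that])
  qed
  show ?thesis
  proof
    fix A B C and c :: 'a
    assume A: "A \<in> gl scale" and B: "B \<in> gl scale"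
    show "gl_bracket \<beta> A B \<in> gl scale" by (rule gl_gl_bracket[OF V lin bij A B])
    show "gl_bracket \<beta> (pointwise_scale scale c A) B =
        pointwise_scale scale c (gl_bracket \<beta> A B)"
      by (simp add: expand sc[OF B] scale_right_diff_distrib)
    show "gl_bracket \<beta> A (pointwise_scale scale c B) =
        pointwise_scale scale c (gl_bracket \<beta> A B)"
      by (simp add: expand sc[OF A] scale_right_diff_distrib)
    show "Ad \<beta> (gl_bracket \<beta> A B) = gl_bracket \<beta> (Ad \<beta> A) (Ad \<beta> B)"
      by (simp add: expand)
    assume C: "C \<in> gl scale"
    show "gl_bracket \<beta> (A + B) C = gl_bracket \<beta> A C + gl_bracket \<beta> B C"
      by (simp add: expand add[OF C])
    show "gl_bracket \<beta> A (B + C) = gl_bracket \<beta> A B + gl_bracket \<beta> A C"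
      by (simp add: expand add[OF A])
    show "gl_bracket \<beta> (Ad \<beta> A) (gl_bracket \<beta> B C) + gl_bracket \<beta> (Ad \<beta> B) (gl_bracket \<beta> C A)
        + gl_bracket \<beta> (Ad \<beta> C) (gl_bracket \<beta> A B) = 0"
      by (simp add: expand diff[OF A] diff[OF B] diff[OF C])
  qed (use subspace_gl[OF V] Ad_onto in \<open>simp_all add: expand\<close>)
qed

section \<open>Derivations\<close>

text \<open>
  A subalgebra inherits every identity; what needs an argument is that the structure map is
  still onto, and closure under it alone does not give this in infinite dimension.
\<close>

lemma hom_lie_algebra_restrict:
  assumes "hom_lie_subalgebra scale L bracket \<phi> H" and "H \<subseteq> \<phi> ` H"
  shows "hom_lie_algebra scale H bracket \<phi>"
proof -
  interpret hom_lie_subalgebra scale L bracket \<phi> H by fact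
  have "bij_betw \<phi> H H"
    using map_bij sub_subset sub_map_closed assms(2)
    by (auto simp: bij_betw_def intro: inj_on_subset)
  moreover have "x \<in> L" if "x \<in> H" for x
    using that sub_subset by blast
  ultimately show ?thesis
    by unfold_locales
      (simp_all add: sub_subspace sub_bracket_closed bracket_add_left bracket_add_right
        bracket_scale_left bracket_scale_right bracket_self map_add map_scale map_bracket
        hom_jacobi)
qed

definition leibniz :: "('g \<Rightarrow> 'g \<Rightarrow> 'g) \<Rightarrow> ('g \<Rightarrow> 'g::ab_group_add) \<Rightarrow> bool" where
  "leibniz m d \<longleftrightarrow> (\<forall>x y. d (m x y) = m x (d y) + m (d x) y)"

lemma leibniz_commutator:
  assumes "additive a" "additive b" "\<And>x. additive (m x)" "\<And>y. additive (\<lambda>x. m x y)"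
    and "leibniz m a" "leibniz m b"
  shows "leibniz m ((a \<circ> b) - (b \<circ> a))"
proof -
  have a: "a (x + y) = a x + a y" and b: "b (x + y) = b x + b y" for x y
    by (rule additive.add[OF assms(1)], rule additive.add[OF assms(2)])
  have m: "m x (y - z) = m x y - m x z" "m (y - z) x = m y x - m z x" for x y z
    by (rule additive.diff[OF assms(3)], rule additive.diff[OF assms(4)])
  show ?thesis
    using assms(5,6) by (simp add: leibniz_def a b m)
qed

lemma leibniz_conjugate:
  assumes "additive f" "bij f" "\<And>x y. f (m x y) = m (f x) (f y)" "leibniz m d"
  shows "leibniz m (f \<circ> d \<circ> inv f)"
proof -
  have [simp]: "inv f (f x) = x" "f (inv f x) = x" for x
    using assms(2) by (simp_all add: bij_is_inj bij_is_surj surj_f_inv_f)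
  have "inv f (m x y) = m (inv f x) (inv f y)" for x y
    by (simp add: inv_f_eq[OF bij_is_inj[OF assms(2)]] assms(3))
  then show ?thesis
    using assms(4) by (simp add: leibniz_def additive.add[OF assms(1)] assms(3))
qed

definition untwisted :: "('g \<Rightarrow> 'g) \<Rightarrow> ('g \<Rightarrow> 'g \<Rightarrow> 'g) \<Rightarrow> 'g \<Rightarrow> 'g \<Rightarrow> 'g" where
  "untwisted \<phi> bracket x y = inv \<phi> (bracket x y)"

lemma hom_lie_map_gl:
  assumes "hom_lie_algebra scale UNIV bracket \<phi>"
  shows "\<phi> \<in> gl scale" "bij \<phi>"
proof -
  interpret hom_lie_algebra scale UNIV bracket \<phi> by fact
  show "\<phi> \<in> gl scale" by (simp add: gl_iff[OF vector_space_axioms] map_add map_scale)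
  show "bij \<phi>" by (rule map_bij)
qed

text \<open>
  The Leibniz rule for \<open>\<phi>\<inverse> \<circ> D\<close> at the vectors \<open>\<phi> x\<close> and \<open>\<phi> y\<close>
  is, up to one application of \<open>\<phi>\<close>, the derivation condition on \<open>D\<close> at \<open>x\<close> and \<open>y\<close>.
\<close>

lemma Der_iff_untwist:
  assumes hom_lie: "hom_lie_algebra scale UNIV bracket \<phi>"
  shows "D \<in> Der scale bracket \<phi> \<longleftrightarrow>
    D \<in> gl scale \<and> leibniz (untwisted \<phi> bracket) (inv \<phi> \<circ> D)"
proof -
  interpret hom_lie_algebra scale UNIV bracket \<phi> by fact
  have bij: "bij \<phi>" by (rule hom_lie_map_gl[OF hom_lie])
  have inv [simp]: "inv \<phi> (\<phi> x) = x" "\<phi> (inv \<phi> x) = x" for x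
    using bij by (simp_all add: bij_is_inj bij_is_surj surj_f_inv_f)
  have inv_bracket: "inv \<phi> (bracket (\<phi> x) (\<phi> y)) = bracket x y" for x y
    by (simp flip: map_bracket)
  have at_images: "leibniz (untwisted \<phi> bracket) (inv \<phi> \<circ> D) \<longleftrightarrow>
      (\<forall>x y. inv \<phi> (D (inv \<phi> (bracket (\<phi> x) (\<phi> y)))) =
        inv \<phi> (bracket (\<phi> x) (inv \<phi> (D (\<phi> y)))) + inv \<phi> (bracket (inv \<phi> (D (\<phi> x))) (\<phi> y)))"
    unfolding leibniz_def untwisted_def comp_def by (metis inv(2))
  \<comment> \<open>Cancels the outer \<open>\<phi>\<inverse>\<close> that remains on both sides of the Leibniz rule.\<close>
  have shift: "inv \<phi> u = inv \<phi> v + inv \<phi> w \<longleftrightarrow> u = v + w" for u v w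
    by (metis inv map_add UNIV_I)
  show ?thesis
    unfolding at_images inv_bracket shift
    by (simp add: Der_def gl_def Ad_def inv_inv_eq[OF bij])
qed

text \<open>
  With \<open>a = \<beta>\<inverse> \<circ> A\<close> and \<open>b = \<beta>\<inverse> \<circ> B\<close>, the product
  \<open>A \<circ> \<beta>\<inverse> \<circ> B \<circ> \<beta>\<inverse>\<close> is
  \<open>\<beta> \<circ> a \<circ> b \<circ> \<beta>\<inverse>\<close>: a bracket in \<open>gl\<close> is a commutator in disguise.
\<close>

lemma untwist_gl_bracket:
  assumes V: "vector_space scale" and lin: "\<beta> \<in> gl scale" and bij: "bij \<beta>"
  shows "inv \<beta> \<circ> gl_bracket \<beta> A B =
    Ad \<beta> (((inv \<beta> \<circ> A) \<circ> (inv \<beta> \<circ> B)) - ((inv \<beta> \<circ> B) \<circ> (inv \<beta> \<circ> A)))"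
proof -
  have diff: "f (x - y) = f x - f y" if "f \<in> gl scale" for f x y
    using that unfolding gl_iff[OF V] by (metis add_diff_cancel_right' diff_add_cancel)
  show ?thesis
    using bij
    by (simp add: gl_bracket_def Ad_def fun_eq_iff diff[OF lin] diff[OF gl_inv[OF V lin bij]]
        bij_is_inj bij_is_surj surj_f_inv_f)
qed

lemma untwist_Ad:
  assumes "bij \<beta>"
  shows "inv \<beta> \<circ> Ad \<beta> A = Ad \<beta> (inv \<beta> \<circ> A)"
  using assms by (simp add: Ad_def fun_eq_iff bij_is_inj bij_is_surj surj_f_inv_f)

lemma untwist_Ad_inv:
  "inv \<beta> \<circ> Ad (inv \<beta>) A = Ad (inv \<beta>) (inv \<beta> \<circ> A)"
  by (simp add: Ad_def comp_assoc)

lemma additive_gl: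
  assumes "vector_space scale" "A \<in> gl scale"
  shows "additive A"
  using assms(2) by (simp add: gl_iff[OF assms(1)] additive_def)

lemma
  assumes hom_lie: "hom_lie_algebra scale UNIV bracket \<phi>"
  shows untwisted_additive_right: "additive (untwisted \<phi> bracket x)"
    and untwisted_additive_left: "additive (\<lambda>x. untwisted \<phi> bracket x y)"
    and untwisted_map: "\<phi> (untwisted \<phi> bracket x y) = untwisted \<phi> bracket (\<phi> x) (\<phi> y)"
    and untwisted_map_inv:
      "inv \<phi> (untwisted \<phi> bracket x y) = untwisted \<phi> bracket (inv \<phi> x) (inv \<phi> y)"
proof -
  interpret hom_lie_algebra scale UNIV bracket \<phi> by fact
  note map = hom_lie_map_gl[OF hom_lie]
  have inv [simp]: "inv \<phi> (\<phi> x) = x" "\<phi> (inv \<phi> x) = x" for x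
    using map(2) by (simp_all add: bij_is_inj bij_is_surj surj_f_inv_f)
  have add: "inv \<phi> (u + v) = inv \<phi> u + inv \<phi> v" for u v
    using gl_inv[OF vector_space_axioms map] by (simp add: gl_iff[OF vector_space_axioms])
  show "additive (untwisted \<phi> bracket x)" "additive (\<lambda>x. untwisted \<phi> bracket x y)"
    by (simp_all add: additive_def untwisted_def bracket_add_left bracket_add_right add)
  show map: "\<phi> (untwisted \<phi> bracket x y) = untwisted \<phi> bracket (\<phi> x) (\<phi> y)" for x y
    by (simp add: untwisted_def flip: map_bracket)
  show "inv \<phi> (untwisted \<phi> bracket x y) = untwisted \<phi> bracket (inv \<phi> x) (inv \<phi> y)"
    using map[of "inv \<phi> x" "inv \<phi> y"] by (metis inv)
qed

lemma subspace_Der: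
  assumes hom_lie: "hom_lie_algebra scale UNIV bracket \<phi>"
  shows "module.subspace (pointwise_scale scale) (Der scale bracket \<phi>)"
proof -
  interpret hom_lie_algebra scale UNIV bracket \<phi> by fact
  note V = vector_space_axioms
  note map = hom_lie_map_gl[OF hom_lie]
  have Ad_inv_eq: "Ad (inv \<phi>) A = inv \<phi> \<circ> A \<circ> \<phi>" for A
    by (simp add: Ad_def inv_inv_eq[OF map(2)])
  have add: "inv \<phi> (u + v) = inv \<phi> u + inv \<phi> v"
    and sc: "inv \<phi> (scale c u) = scale c (inv \<phi> u)" for c u v
    using gl_inv[OF V map] by (simp_all add: gl_iff[OF V])
  have zero: "inv \<phi> 0 = 0" using sc[of 0 0] by simp
  have bracket_zero: "bracket x 0 = 0" "bracket 0 x = 0" for x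
    using bracket_scale_right[of x 0 0] bracket_scale_left[of 0 x 0] by simp_all
  interpret P: vector_space "pointwise_scale scale"
    by (rule vector_space_pointwise_scale) (rule V)
  have "P.subspace (gl scale)" by (rule subspace_gl) (rule V)
  then show ?thesis
    unfolding P.subspace_def Der_def gl_def Ad_inv_eq
    by (auto simp: pointwise_scale_def add sc zero bracket_zero bracket_add_left
        bracket_add_right bracket_scale_left bracket_scale_right scale_right_distrib ac_simps)
qed

lemma Der_gl_bracket:
  assumes hom_lie: "hom_lie_algebra scale UNIV bracket \<phi>"
    and A: "A \<in> Der scale bracket \<phi>" and B: "B \<in> Der scale bracket \<phi>"
  shows "gl_bracket \<phi> A B \<in> Der scale bracket \<phi>"
proof -
  interpret hom_lie_algebra scale UNIV bracket \<phi> by fact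
  note V = vector_space_axioms
  note map = hom_lie_map_gl[OF hom_lie]
  note Der_iff = Der_iff_untwist[OF hom_lie]
  let ?a = "inv \<phi> \<circ> A" and ?b = "inv \<phi> \<circ> B"
  have gl: "A \<in> gl scale" "B \<in> gl scale"
    and leibniz: "leibniz (untwisted \<phi> bracket) ?a" "leibniz (untwisted \<phi> bracket) ?b"
    using A B by (simp_all add: Der_iff)
  have "additive ?a" "additive ?b"
    by (intro additive_gl[OF V] gl_compose[OF V] gl_inv[OF V map] gl)+
  then have "leibniz (untwisted \<phi> bracket) ((?a \<circ> ?b) - (?b \<circ> ?a))"
    by (intro leibniz_commutator leibniz untwisted_additive_right[OF hom_lie]
        untwisted_additive_left[OF hom_lie])
  then have "leibniz (untwisted \<phi> bracket) (Ad \<phi> ((?a \<circ> ?b) - (?b \<circ> ?a)))"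
    unfolding Ad_def
    by (rule leibniz_conjugate[where m = "untwisted \<phi> bracket",
        OF additive_gl[OF V map(1)] map(2) untwisted_map[OF hom_lie]])
  then show ?thesis
    unfolding Der_iff untwist_gl_bracket[OF V map]
    by (intro conjI gl_gl_bracket[OF V map] gl)
qed

lemma Der_Ad:
  assumes hom_lie: "hom_lie_algebra scale UNIV bracket \<phi>" and D: "D \<in> Der scale bracket \<phi>"
  shows "Ad \<phi> D \<in> Der scale bracket \<phi>" and "Ad (inv \<phi>) D \<in> Der scale bracket \<phi>"
proof -
  interpret hom_lie_algebra scale UNIV bracket \<phi> by fact
  note V = vector_space_axioms
  note map = hom_lie_map_gl[OF hom_lie]
  note map_inv = gl_inv[OF V map] bij_imp_bij_inv[OF map(2)]
  note Der_iff = Der_iff_untwist[OF hom_lie]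
  have gl: "D \<in> gl scale" and leibniz: "leibniz (untwisted \<phi> bracket) (inv \<phi> \<circ> D)"
    using D by (simp_all add: Der_iff)
  have "leibniz (untwisted \<phi> bracket) (Ad \<phi> (inv \<phi> \<circ> D))"
    unfolding Ad_def
    by (rule leibniz_conjugate[where m = "untwisted \<phi> bracket",
        OF additive_gl[OF V map(1)] map(2) untwisted_map[OF hom_lie] leibniz])
  then show "Ad \<phi> D \<in> Der scale bracket \<phi>"
    unfolding Der_iff untwist_Ad[OF map(2)] by (intro conjI gl_Ad[OF V map] gl)
  have "leibniz (untwisted \<phi> bracket) (Ad (inv \<phi>) (inv \<phi> \<circ> D))"
    unfolding Ad_def
    by (rule leibniz_conjugate[where m = "untwisted \<phi> bracket",
        OF additive_gl[OF V map_inv(1)] map_inv(2) untwisted_map_inv[OF hom_lie] leibniz])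
  then show "Ad (inv \<phi>) D \<in> Der scale bracket \<phi>"
    unfolding Der_iff untwist_Ad_inv by (intro conjI gl_Ad[OF V map_inv] gl)
qed

theorem proposition3p5:
  fixes scale :: "'k::field \<Rightarrow> 'g::ab_group_add \<Rightarrow> 'g"
    and bracket :: "'g \<Rightarrow> 'g \<Rightarrow> 'g"
    and \<phi> :: "'g \<Rightarrow> 'g"
  assumes "hom_lie_algebra scale UNIV bracket \<phi>"
  shows "hom_lie_algebra (pointwise_scale scale) (Der scale bracket \<phi>) (gl_bracket \<phi>) (Ad \<phi>)
       \<and> hom_lie_subalgebra (pointwise_scale scale) (gl scale) (gl_bracket \<phi>) (Ad \<phi>)
           (Der scale bracket \<phi>)"
proof
  interpret hom_lie_algebra scale UNIV bracket \<phi> by fact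
  note map = hom_lie_map_gl[OF assms]
  interpret E: hom_lie_algebra "pointwise_scale scale" "gl scale" "gl_bracket \<phi>" "Ad \<phi>"
    by (rule hom_lie_algebra_gl[OF vector_space_axioms map])
  show sub: "hom_lie_subalgebra (pointwise_scale scale) (gl scale) (gl_bracket \<phi>) (Ad \<phi>)
      (Der scale bracket \<phi>)"
  proof
    show "Der scale bracket \<phi> \<subseteq> gl scale" by (auto simp: Der_def gl_def)
  qed (use subspace_Der[OF assms] Der_gl_bracket[OF assms] Der_Ad[OF assms] in auto)
  have "bij_betw (Ad \<phi>) (Der scale bracket \<phi>) (Der scale bracket \<phi>)"
    by (rule bij_betw_Ad[OF map(2)]) (use Der_Ad[OF assms] in auto)
  then show "hom_lie_algebra (pointwise_scale scale) (Der scale bracket \<phi>) (gl_bracket \<phi>) (Ad \<phi>)"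
    by (intro hom_lie_algebra_restrict[OF sub]) (simp add: bij_betw_def)
qed

end
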